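(* Let $\alpha\in(0,1)$ be irrational, let $T(x)=(x+\alpha)\bmod 1$ on the circle $\mathbb{R}/\mathbb{Z}$ (represented by $[0,1)$), and let $\mathcal{P}=\{[0,1-\alpha),[1-\alpha,1)\}$. Let $\mathcal{R}$ be a Sturmian-measurable non-trivial partition of the circle. Let $\ell$ be the largest non-negative integer and $n$ the least positive integer such that $\mathcal{R}$ is rougher than $T^{-\ell}\mathcal{P}^n$. If $k\geq 1$ is an integer such that $r_{k-1}\leq n<r_k$, then $$\mathcal{R}^{r_{k+3}+2r_k-n-2}=T^{-\ell}\mathcal{P}^{r_{k+3}+2r_k-3}=\left(T^{-\ell}\mathcal{P}\right)^{r_{k+3}+2r_k-3}.$$
   Context: $\mathbb{N}$ contains $0$. A partition of a set $X$ is a set of non-empty pairwise disjoint subsets covering $X$; it is non-trivial if it has at least two elements. A partition $\mathcal{R}$ is rougher than $\mathcal{R}'$ if every element of $\mathcal{R}'$ is a subset of an element of $\mathcal{R}$ (equality allowed). For an integer $j$, $T^{-j}\mathcal{R}=\{T^{-j}R : R\in\mathcal{R}\}$. For $n\geq 1$, $\mathcal{R}^{n}=\{\bigcap_{j=0}^{n-1}T^{-j}R_j : R_0,\ldots,R_{n-1}\in\mathcal{R}\}\setminus\{\emptyset\}$. A partition of the circle is Sturmian-measurable if it is a finite partition whose elements are finite unions of left-closed right-open intervals with endpoints in $\{T^{-i}(0): i\in\mathbb{N}\}$. Meaning of $\ell$ and $n$: among all pairs $(s,m)$ such that $\mathcal{R}$ is rougher than $T^{-s}\mathcal{P}^m$,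 there is one which simultaneously maximizes $s$ and minimizes $m$; $(\ell,n)$ is this pair. Equivalently, with $\mathcal{C}(\mathcal{R})=\{i\in\mathbb{Z} : T^{-i}(0)\in\partial\mathcal{R}\}$, where $\partial\mathcal{R}$ is the union of the boundaries (in the circle) of the elements of $\mathcal{R}$, one has $\ell=\min\mathcal{C}(\mathcal{R})$ and $n=\max\mathcal{C}(\mathcal{R})-\min\mathcal{C}(\mathcal{R})$. Continued fraction notation: $\alpha=[c_1,c_2,c_3,\ldots]=\cfrac{1}{c_1+\cfrac{1}{c_2+\cdots}}$ with integers $c_i\geq 1$; $q_0=1$, $q_1=c_1$, $q_k=c_kq_{k-1}+q_{k-2}$ for $k\ge 2$; $r_0=1$ and $r_k=q_k+q_{k-1}$ for $k\geq 1$. *)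

theory Defs
  imports Complex_Main "HOL-Library.Disjoint_Sets"
begin

definition circle :: "real set" where
  "circle = {0..<1}"

definition rot :: "real \<Rightarrow> real \<Rightarrow> real" where
  "rot \<alpha> x = frac (x + \<alpha>)"

text \<open>The preimage of a subset of the circle, and of a partition element by element, under
  the \<open>j\<close>-th iterate of the rotation.\<close>

definition preim :: "real \<Rightarrow> nat \<Rightarrow> real set \<Rightarrow> real set" where
  "preim \<alpha> j A = {x \<in> circle. (rot \<alpha> ^^ j) x \<in> A}"

definition pull :: "real \<Rightarrow> nat \<Rightarrow> real set set \<Rightarrow> real set set" where
  "pull \<alpha> j R = preim \<alpha> j ` R"

text \<open>The refinement \<open>R\<^sup>n\<close>; only meaningful for \<open>n \<ge> 1\<close>.\<close>

definition part_pow :: "real \<Rightarrow> real set set \<Rightarrow> nat \<Rightarrow> real set set" where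
  "part_pow \<alpha> R n = {(\<Inter>j<n. preim \<alpha> j (f j)) | f. \<forall>j<n. f j \<in> R} - {{}}"

definition sturm_part :: "real \<Rightarrow> real set set" where
  "sturm_part \<alpha> = {{0..<1 - \<alpha>}, {1 - \<alpha>..<1}}"

text \<open>The left-closed right-open arc running from \<open>a\<close> to \<open>b\<close> in the positive direction, for
  \<open>a\<close>, \<open>b\<close> in the circle; it passes through 0 when \<open>b < a\<close>, and is the whole circle when
  \<open>a = b\<close>.\<close>

definition arc :: "real \<Rightarrow> real \<Rightarrow> real set" where
  "arc a b = (if a < b then {a..<b} else {a..<1} \<union> {0..<b})"

definition back_orbit :: "real \<Rightarrow> real set" where
  "back_orbit \<alpha> = {x \<in> circle. \<exists>i. (rot \<alpha> ^^ i) x = 0}"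

definition sturmian_measurable :: "real \<Rightarrow> real set set \<Rightarrow> bool" where
  "sturmian_measurable \<alpha> R \<longleftrightarrow>
     partition_on circle R \<and> finite R \<and>
     (\<forall>A\<in>R. \<exists>F. finite F \<and> F \<subseteq> {arc a b | a b. a \<in> back_orbit \<alpha> \<and> b \<in> back_orbit \<alpha>} \<and> A = \<Union>F)"

text \<open>\<open>refines circle Q R\<close> says that \<open>R\<close> is rougher than \<open>Q\<close>. The pair \<open>(l, n)\<close> simultaneously
  maximizes \<open>s\<close> and minimizes \<open>m\<close> among all pairs \<open>(s, m)\<close>, \<open>m \<ge> 1\<close>, such that \<open>R\<close> is rougher
  than the preimage under the \<open>s\<close>-th iterate of the \<open>m\<close>-th refinement of the Sturmian
  partition.\<close>

definition optimal_pair :: "real \<Rightarrow> real set set \<Rightarrow> nat \<Rightarrow> nat \<Rightarrow> bool" where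
  "optimal_pair \<alpha> R l n \<longleftrightarrow>
     n \<ge> 1 \<and> refines circle (pull \<alpha> l (part_pow \<alpha> (sturm_part \<alpha>) n)) R \<and>
     (\<forall>s m. m \<ge> 1 \<and> refines circle (pull \<alpha> s (part_pow \<alpha> (sturm_part \<alpha>) m)) R
        \<longrightarrow> s \<le> l \<and> n \<le> m)"

text \<open>\<open>cf_trunc c i m\<close> is the finite continued fraction
  \<open>1 / (c i + 1 / (c (i + 1) + \<dots> + 1 / c (i + m - 1)))\<close> with \<open>m\<close> partial quotients. The
  value \<open>c 0\<close> is never used below.\<close>

fun cf_trunc :: "(nat \<Rightarrow> nat) \<Rightarrow> nat \<Rightarrow> nat \<Rightarrow> real" where
  "cf_trunc c i 0 = 0"
| "cf_trunc c i (Suc m) = 1 / (real (c i) + cf_trunc c (Suc i) m)"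

definition has_cf :: "real \<Rightarrow> (nat \<Rightarrow> nat) \<Rightarrow> bool" where
  "has_cf \<alpha> c \<longleftrightarrow> (\<forall>i\<ge>1. c i \<ge> 1) \<and> (\<lambda>m. cf_trunc c 1 m) \<longlonglongrightarrow> \<alpha>"

fun cf_q :: "(nat \<Rightarrow> nat) \<Rightarrow> nat \<Rightarrow> nat" where
  "cf_q c 0 = 1"
| "cf_q c (Suc 0) = c 1"
| "cf_q c (Suc (Suc k)) = c (Suc (Suc k)) * cf_q c (Suc k) + cf_q c k"

fun cf_r :: "(nat \<Rightarrow> nat) \<Rightarrow> nat \<Rightarrow> nat" where
  "cf_r c 0 = 1"
| "cf_r c (Suc k) = cf_q c (Suc k) + cf_q c k"

end

theory Submission
  imports Defs
begin

text \<open>Let \<open>G\<close> be the coding by the cells of \<open>R\<close>, moved by \<open>l \<alpha>\<close>: it is constant between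
  consecutive points among \<open>-i \<alpha>\<close>, \<open>0 \<le> i \<le> n\<close>, and optimality of \<open>(l, n)\<close> makes it jump at \<open>0\<close>
  and at \<open>-n \<alpha>\<close>. Suppose that \<open>G\<close> agrees on the first \<open>N\<close> points of the orbits of \<open>u\<close> and \<open>v\<close>,
  and write \<open>\<eta> = \<bar>q\<^bsub>k+2\<^esub> \<alpha> - p\<^bsub>k+2\<^esub>\<bar>\<close>. Every interval of length \<open>\<eta>\<close> is visited within
  \<open>r\<^bsub>k+3\<^esub>\<close> steps, so the coding shifted by \<open>v - u\<close> has breaks within \<open>\<eta>\<close> of both jumps, that is,
  \<open>v - u\<close> is within \<open>\<eta>\<close> of \<open>-b \<alpha>\<close> and of \<open>a \<alpha>\<close> with \<open>0 \<le> a, b \<le> n\<close>, and \<open>G\<close> differs from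
  the shifted coding between each jump and its break. If \<open>a + b > 0\<close>, then \<open>a + b < q\<^bsub>k+3\<^esub>\<close>, so
  \<open>(a + b) \<alpha>\<close> has distance at least \<open>\<eta>\<close> from the integers; the two intervals of disagreement join
  up, along the orbit, to an interval of that length, which is visited in time: a contradiction.
  So \<open>v - u\<close> has distance less than \<open>\<eta>\<close> from the integers, and then a point \<open>-i \<alpha>\<close>,
  \<open>i < N + n\<close>, separating \<open>u\<close> from \<open>v\<close> is carried to one of the two jumps, where \<open>G\<close> tells the
  orbits apart.\<close>

section \<open>Continued fractions and visits of the rotation\<close>

locale irrational_cf =
  fixes \<alpha> :: real and c :: "nat \<Rightarrow> nat"
  assumes irrational: "\<alpha> \<notin> \<rat>" and has_cf: "has_cf \<alpha> c"
begin

lemma c_ge_1: "i \<ge> 1 \<Longrightarrow> c i \<ge> 1"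
  using has_cf by (simp add: has_cf_def)

lemma cf_trunc_bounds: "i \<ge> 1 \<Longrightarrow> 0 \<le> cf_trunc c i m \<and> cf_trunc c i m \<le> 1"
proof (induction m arbitrary: i)
  case (Suc m)
  have "0 \<le> cf_trunc c (Suc i) m" using Suc.IH[of "Suc i"] by simp
  moreover have "real (c i) \<ge> 1" using c_ge_1[OF Suc.prems] by simp
  ultimately show ?case by (simp add: field_simps)
qed simp

text \<open>The remainder \<open>[c_(i+1), c_(i+2), ...]\<close>, obtained from
  \<open>\<alpha>\<close> by inverting and subtracting the given digits;
  \<open>cf_trunc_tendsto_tail\<close> identifies it with the value of that expansion.\<close>

fun tail :: "nat \<Rightarrow> real" where
  "tail 0 = \<alpha>"
| "tail (Suc i) = 1 / tail i - real (c (Suc i))"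

lemma tail_irrational: "tail i \<notin> \<rat>"
proof (induction i)
  case (Suc i)
  show ?case
  proof
    assume "tail (Suc i) \<in> \<rat>"
    then have "1 / (tail (Suc i) + real (c (Suc i))) \<in> \<rat>" by (intro Rats_divide Rats_add) auto
    then show False using Suc by simp
  qed
qed (use irrational in simp)

lemma cf_trunc_tendsto_tail: "(\<lambda>m. cf_trunc c (Suc i) m) \<longlonglongrightarrow> tail i"
proof (induction i)
  case 0
  show ?case using has_cf by (simp add: has_cf_def)
next
  case (Suc i)
  have "tail i \<noteq> 0" using tail_irrational[of i] by auto
  have "(\<lambda>m. cf_trunc c (Suc i) (Suc m)) \<longlonglongrightarrow> tail i"
    using LIMSEQ_Suc[OF Suc] .
  then have "(\<lambda>m. inverse (cf_trunc c (Suc i) (Suc m)) - real (c (Suc i)))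
      \<longlonglongrightarrow> inverse (tail i) - real (c (Suc i))"
    using \<open>tail i \<noteq> 0\<close> by (intro tendsto_intros)
  then show ?case by (simp add: inverse_eq_divide)
qed

lemma tail_bounds: "0 < tail i" "tail i < 1"
proof -
  have "0 \<le> tail i"
    by (rule LIMSEQ_le_const[OF cf_trunc_tendsto_tail]) (use cf_trunc_bounds in auto)
  moreover have "tail i \<le> 1"
    by (rule LIMSEQ_le_const2[OF cf_trunc_tendsto_tail]) (use cf_trunc_bounds in auto)
  ultimately show "0 < tail i" "tail i < 1"
    using tail_irrational[of i] by (auto simp: order_less_le)
qed

section \<open>Convergents and their errors \<open>q_j \<alpha> - p_j\<close>\<close>

fun cf_p :: "nat \<Rightarrow> int" where
  "cf_p 0 = 0"
| "cf_p (Suc 0) = 1"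
| "cf_p (Suc (Suc k)) = int (c (Suc (Suc k))) * cf_p (Suc k) + cf_p k"

text \<open>The classical product formula for \<open>\<bar>q_j \<alpha> - p_j\<bar>\<close>; see
  \<open>convergent_error\<close>.\<close>

definition eta :: "nat \<Rightarrow> real" where
  "eta j = (\<Prod>i\<le>j. tail i)"

lemma eta_pos: "0 < eta j"
  unfolding eta_def by (intro prod_pos) (use tail_bounds in auto)

lemma eta_Suc_less: "eta (Suc j) < eta j"
  using eta_pos[of j] tail_bounds[of "Suc j"] mult_strict_left_mono[of "tail (Suc j)" 1 "eta j"]
  by (simp add: eta_def)

lemma eta_rec: "eta (Suc (Suc j)) = eta j - real (c (Suc (Suc j))) * eta (Suc j)"
proof -
  have "tail (Suc j) \<noteq> 0" using tail_bounds(1)[of "Suc j"] by linarith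
  then have *: "tail (Suc j) * tail (Suc (Suc j)) = 1 - real (c (Suc (Suc j))) * tail (Suc j)"
    unfolding tail.simps(2)[of "Suc j"] by (simp add: right_diff_distrib del: tail.simps)
  have "eta (Suc (Suc j)) = eta j * (tail (Suc j) * tail (Suc (Suc j)))"
    by (simp add: eta_def del: tail.simps)
  also have "\<dots> = eta j - real (c (Suc (Suc j))) * (eta j * tail (Suc j))"
    unfolding * by (simp add: right_diff_distrib del: tail.simps)
  also have "eta j * tail (Suc j) = eta (Suc j)" by (simp add: eta_def del: tail.simps)
  finally show ?thesis .
qed

lemma two_eta_le: "2 * eta (Suc (Suc j)) \<le> eta j"
proof -
  have "1 * eta (Suc j) \<le> real (c (Suc (Suc j))) * eta (Suc j)"
    using eta_pos[of "Suc j"] c_ge_1[of "Suc (Suc j)"] by (intro mult_right_mono) auto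
  then show ?thesis using eta_rec[of j] eta_Suc_less[of "Suc j"] by simp
qed

lemma eta_le_1: "eta j \<le> 1"
proof (induction j)
  case 0
  then show ?case using tail_bounds(2)[of 0] by (simp add: eta_def)
next
  case (Suc j)
  then show ?case using eta_Suc_less[of j] by simp
qed

lemma convergent_error: "real (cf_q c j) * \<alpha> - of_int (cf_p j) = (-1) ^ j * eta j"
proof (induction j rule: induct_nat_012)
  case 1
  have "\<alpha> \<noteq> 0" using tail_bounds(1)[of 0] by simp
  then show ?case by (simp add: eta_def field_simps)
next
  case (ge2 k)
  let ?c = "real (c (Suc (Suc k)))"
  have "real (cf_q c (Suc (Suc k))) * \<alpha> - of_int (cf_p (Suc (Suc k)))
      = ?c * (real (cf_q c (Suc k)) * \<alpha> - of_int (cf_p (Suc k)))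
        + (real (cf_q c k) * \<alpha> - of_int (cf_p k))"
    by (simp add: algebra_simps)
  also have "\<dots> = (-1) ^ Suc (Suc k) * eta (Suc (Suc k))"
    unfolding ge2 eta_rec by (simp add: algebra_simps)
  finally show ?case .
qed (simp add: eta_def)

lemma convergent_det:
  "int (cf_q c (Suc j)) * cf_p j - int (cf_q c j) * cf_p (Suc j) = (-1) ^ Suc j"
proof (induction j)
  case (Suc j)
  then show ?case by (simp add: algebra_simps)
qed simp

lemma cf_q_pos: "cf_q c j > 0"
proof (induction j rule: induct_nat_012)
  case 1
  show ?case using c_ge_1[of 1] by simp
qed simp_all

lemma cf_q_add_le: "cf_q c (Suc j) + cf_q c j \<le> cf_q c (Suc (Suc j))"
  using c_ge_1[of "Suc (Suc j)"] by simp

text \<open>Consecutive convergents form a unimodular matrix, so \<open>(m, z)\<close> is an integer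
  combination of them with coefficients \<open>a\<close>, \<open>b\<close>. From
  \<open>0 < m < q_(j+1)\<close> it follows that \<open>b\<close> is nonzero and \<open>a\<close> is
  zero or of the other sign. The two errors have opposite signs too, so their contributions add up
  instead of cancelling.\<close>

lemma best_approximation:
  assumes "1 \<le> m" "m < cf_q c (Suc j)"
  shows "eta j \<le> \<bar>real m * \<alpha> - of_int z\<bar>"
proof -
  let ?q = "\<lambda>i. int (cf_q c i)"
  define s :: int where "s = (-1) ^ Suc j"
  \<comment> \<open>Cramer's rule; the determinant \<open>s\<close> is a sign, hence its own
    inverse.\<close>
  define a where "a = s * (int m * cf_p j - z * ?q j)"
  define b where "b = s * (z * ?q (Suc j) - int m * cf_p (Suc j))"
  have s: "s * s = 1" unfolding s_def by (metis power_mult_distrib mult_minus1 minus_minus power_one)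
  have det: "?q (Suc j) * cf_p j - ?q j * cf_p (Suc j) = s"
    unfolding s_def by (rule convergent_det)
  have m: "int m = a * ?q (Suc j) + b * ?q j"
  proof -
    have "a * ?q (Suc j) + b * ?q j = s * (int m * (?q (Suc j) * cf_p j - ?q j * cf_p (Suc j)))"
      unfolding a_def b_def by (simp only: algebra_simps)
    also have "\<dots> = int m * (s * s)" unfolding det by (simp only: ac_simps)
    finally show ?thesis using s by simp
  qed
  have z: "z = a * cf_p (Suc j) + b * cf_p j"
  proof -
    have "a * cf_p (Suc j) + b * cf_p j = s * (z * (?q (Suc j) * cf_p j - ?q j * cf_p (Suc j)))"
      unfolding a_def b_def by (simp only: algebra_simps)
    also have "\<dots> = z * (s * s)" unfolding det by (simp only: ac_simps)
    finally show ?thesis using s by simp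
  qed
  have q: "?q (Suc j) > 0" "?q j > 0" using cf_q_pos by simp_all
  have mq: "0 < int m" "int m < ?q (Suc j)" using assms by simp_all
  have "real m * \<alpha> - of_int z
      = of_int a * (real (cf_q c (Suc j)) * \<alpha> - of_int (cf_p (Suc j)))
        + of_int b * (real (cf_q c j) * \<alpha> - of_int (cf_p j))"
  proof -
    have "real m = of_int a * real (cf_q c (Suc j)) + of_int b * real (cf_q c j)"
      using arg_cong[OF m, of real_of_int] by simp
    then show ?thesis by (simp add: z algebra_simps)
  qed
  also have "\<dots> = (-1) ^ j * (of_int b * eta j - of_int a * eta (Suc j))"
    unfolding convergent_error by (simp add: algebra_simps)
  finally have eq: "\<bar>real m * \<alpha> - of_int z\<bar> = \<bar>of_int b * eta j - of_int a * eta (Suc j)\<bar>"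
    by (simp add: abs_mult)
  have "(b \<ge> 1 \<and> a \<le> 0) \<or> (b \<le> -1 \<and> a \<ge> 0)"
  proof (cases "a \<le> 0")
    case True
    then have "a * ?q (Suc j) \<le> 0" using q(1) by (simp add: mult_nonpos_nonneg)
    then have "0 < b * ?q j" using m mq by linarith
    then have "b > 0" using q(2) by (simp add: zero_less_mult_iff)
    then show ?thesis using True by simp
  next
    case False
    then have "1 * ?q (Suc j) \<le> a * ?q (Suc j)" using q(1) by (intro mult_right_mono) auto
    then have "b * ?q j < 0" using m mq by linarith
    then have "b < 0" using q(2) by (simp add: mult_less_0_iff)
    then show ?thesis using False by simp
  qed
  then show ?thesis
  proof
    assume "b \<ge> 1 \<and> a \<le> 0"
    then have "1 * eta j \<le> of_int b * eta j" "of_int a * eta (Suc j) \<le> 0"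
      using eta_pos[of j] eta_pos[of "Suc j"] by (auto intro!: mult_right_mono mult_nonpos_nonneg)
    then show ?thesis unfolding eq by linarith
  next
    assume "b \<le> -1 \<and> a \<ge> 0"
    then have "of_int b * eta j \<le> (-1) * eta j" "of_int a * eta (Suc j) \<ge> 0"
      using eta_pos[of j] eta_pos[of "Suc j"]
      by (intro mult_right_mono, auto)
    then show ?thesis unfolding eq by linarith
  qed
qed

text \<open>An entry time \<open>j\<close> into an interval of length \<open>eta K\<close> that is at least \<open>r\<^bsub>K+1\<^esub>\<close> is not the
  first one: stepping back by \<open>q\<^bsub>K+1\<^esub>\<close> or by \<open>q\<^bsub>K+1\<^esub> + q\<^bsub>K\<^esub>\<close> stays inside.\<close>

lemma orbit_hits:
  assumes "eta K \<le> L"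
  obtains j z where "j < cf_r c (Suc K)" "a \<le> y + real j * \<alpha> - of_int z"
    "y + real j * \<alpha> - of_int z < a + L"
proof -
  define P where "P j \<longleftrightarrow> (\<exists>z::int. 0 \<le> y - a + real j * \<alpha> - of_int z \<and>
    y - a + real j * \<alpha> - of_int z < eta K)" for j
  define h where "h = eta (Suc K)"
  define q where "q = cf_q c (Suc K)"
  define q' where "q' = cf_q c K"
  define p where "p = cf_p (Suc K)"
  define p' where "p' = cf_p K"
  have h: "0 < h" "h < eta K" unfolding h_def by (rule eta_pos eta_Suc_less)+
  obtain s :: real where s: "s = 1 \<or> s = -1"
    and e: "real q * \<alpha> = of_int p + s * h" and e': "real q' * \<alpha> = of_int p' - s * eta K"
  proof
    show "(-1::real) ^ Suc K = 1 \<or> (-1::real) ^ Suc K = -1" by (simp add: minus_one_power_iff)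
    show "real q * \<alpha> = of_int p + (-1) ^ Suc K * h"
      using convergent_error[of "Suc K"] by (simp add: q_def p_def h_def)
    show "real q' * \<alpha> = of_int p' - (-1) ^ Suc K * eta K"
      using convergent_error[of K] by (simp add: q'_def p'_def)
  qed
  have "\<exists>j. P j"
  proof -
    \<comment> \<open>Multiples of \<open>q\<close> move the point by steps \<open>s * h\<close>
      shorter than the interval. The integer \<open>Z\<close> puts the start on the side from which
      the steps lead towards \<open>0\<close>, and \<open>t\<close> counts the steps until
      \<open>[0, h)\<close> is reached.\<close>
    define Z where "Z = (if s = 1 then \<lceil>y - a\<rceil> else \<lfloor>y - a\<rfloor>)"
    define x where "x = y - a - of_int Z"
    define t where "t = (if s = 1 then nat \<lceil>- x / h\<rceil> else nat \<lfloor>x / h\<rfloor>)"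
    have "0 \<le> x + real t * (s * h) \<and> x + real t * (s * h) < h"
    proof (cases "s = 1")
      case True
      then have "x \<le> 0" by (simp add: x_def Z_def)
      then have "real t = of_int \<lceil>- x / h\<rceil>" using h True
        by (simp add: t_def of_nat_nat divide_nonneg_pos)
      then have "- x / h \<le> real t" "real t < - x / h + 1" by linarith+
      then show ?thesis using h True by (simp add: field_simps)
    next
      case False
      then have "x \<ge> 0" by (simp add: x_def Z_def)
      then have "real t = of_int \<lfloor>x / h\<rfloor>" using h False
        by (simp add: t_def of_nat_nat)
      then have "real t \<le> x / h" "x / h < real t + 1" by linarith+
      then show ?thesis using h False s by (simp add: field_simps)
    qed
    moreover have "x + real t * (s * h)
        = y - a + real (t * q) * \<alpha> - of_int (Z + int t * p)"
    proof -
      have "real (t * q) * \<alpha> = real t * (of_int p + s * h)" by (simp flip: e)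
      then show ?thesis by (simp add: x_def algebra_simps)
    qed
    ultimately have "P (t * q)" unfolding P_def using h(2) by (intro exI[of _ "Z + int t * p"]) linarith
    then show ?thesis by blast
  qed
  then obtain j where j: "P j" and min: "\<And>i. i < j \<Longrightarrow> \<not> P i"
    by (metis LeastI not_less_Least)
  obtain z :: int where z: "0 \<le> y - a + real j * \<alpha> - of_int z"
    "y - a + real j * \<alpha> - of_int z < eta K" using j unfolding P_def by blast
  define u where "u = y - a + real j * \<alpha> - of_int z"
  have u: "0 \<le> u" "u < eta K" using z by (simp_all add: u_def)
  have "j < q + q'"
  proof (rule ccontr)
    assume "\<not> j < q + q'"
    then have jge: "q + q' \<le> j" by simp
    have q0: "q > 0" "q' > 0" unfolding q_def q'_def by (rule cf_q_pos)+
    \<comment> \<open>The two displacements \<open>- s * h\<close> and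
      \<open>s * (eta K - h)\<close> have opposite signs and sizes adding up to
      \<open>eta K\<close>, so one of them keeps \<open>u\<close> in the half-open interval.\<close>
    have e1: "y - a + real (j - q) * \<alpha> - of_int (z - p) = u - s * h"
      using jge e by (simp add: u_def of_nat_diff algebra_simps)
    have e2: "y - a + real (j - (q + q')) * \<alpha> - of_int (z - p - p') = u - s * h + s * eta K"
      using jge e e' by (simp add: u_def of_nat_diff algebra_simps)
    have "\<not> (0 \<le> u - s * h \<and> u - s * h < eta K)"
      using min[of "j - q"] jge q0 e1 unfolding P_def by (metis diff_less less_le_trans add_gr_0)
    moreover have "\<not> (0 \<le> u - s * h + s * eta K \<and> u - s * h + s * eta K < eta K)"
      using min[of "j - (q + q')"] jge q0 e2 unfolding P_def by (metis diff_less less_le_trans add_gr_0)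
    ultimately show False using s h u by auto
  qed
  then show ?thesis using that[of j z] u assms by (simp add: q_def q'_def u_def)
qed

end

section \<open>Codings of the rotation\<close>

text \<open>\<open>same_floors \<alpha> m u v\<close> says that \<open>u\<close> and \<open>v\<close>, taken modulo 1, lie in the same element of the
  \<open>m\<close>-th refinement of the Sturmian partition: no point \<open>-i \<alpha>\<close> with \<open>i \<le> m\<close> separates them.\<close>

definition same_floors :: "real \<Rightarrow> nat \<Rightarrow> real \<Rightarrow> real \<Rightarrow> bool" where
  "same_floors \<alpha> m u v \<longleftrightarrow>
     (\<forall>i\<le>m. \<lfloor>u + real i * \<alpha>\<rfloor> - \<lfloor>u\<rfloor> = \<lfloor>v + real i * \<alpha>\<rfloor> - \<lfloor>v\<rfloor>)"

lemma same_floors_sym: "same_floors \<alpha> m u v \<Longrightarrow> same_floors \<alpha> m v u"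
  by (simp add: same_floors_def)

lemma floor_shift: "\<lfloor>u + of_int z + w\<rfloor> = \<lfloor>u + w\<rfloor> + z"
  by (metis add.assoc add.commute floor_add_int)

lemma same_floors_shift: "same_floors \<alpha> m (u + of_int z) v \<longleftrightarrow> same_floors \<alpha> m u v"
proof -
  show ?thesis by (simp add: same_floors_def floor_shift)
qed

lemma same_floors_orbit:
  assumes "same_floors \<alpha> (m + j) u v"
  shows "same_floors \<alpha> m (u + real j * \<alpha>) (v + real j * \<alpha>)"
  unfolding same_floors_def
proof (intro allI impI)
  fix i assume "i \<le> m"
  then have "\<lfloor>u + real (i + j) * \<alpha>\<rfloor> - \<lfloor>u\<rfloor> = \<lfloor>v + real (i + j) * \<alpha>\<rfloor> - \<lfloor>v\<rfloor>"
    and "\<lfloor>u + real j * \<alpha>\<rfloor> - \<lfloor>u\<rfloor> = \<lfloor>v + real j * \<alpha>\<rfloor> - \<lfloor>v\<rfloor>"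
    using assms unfolding same_floors_def by (simp_all only: add_mono le_refl le_add2)
  then show "\<lfloor>u + real j * \<alpha> + real i * \<alpha>\<rfloor> - \<lfloor>u + real j * \<alpha>\<rfloor>
      = \<lfloor>v + real j * \<alpha> + real i * \<alpha>\<rfloor> - \<lfloor>v + real j * \<alpha>\<rfloor>"
    by (simp add: distrib_right add.assoc add.commute[of "real j * \<alpha>"])
qed

text \<open>In \<open>jump\<close> only points to the left of \<open>-p \<alpha>\<close> are
  compared with it: by \<open>coded\<close>, \<open>G\<close> is constant just to the right.\<close>

locale rotation_coding = irrational_cf +
  fixes G :: "real \<Rightarrow> 'b" and n k :: nat
  assumes periodic: "G (t + of_int z) = G t"
    and k_pos: "k \<ge> 1" and n_less: "n < cf_r c k"
    and coded: "same_floors \<alpha> n u v \<Longrightarrow> G u = G v"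
    and jump: "p = 0 \<or> p = n \<Longrightarrow>
      \<exists>e0>0. \<forall>e. 0 < e \<and> e < e0 \<longrightarrow> G (- (real p * \<alpha>) - e) \<noteq> G (- (real p * \<alpha>))"
begin

abbreviation "\<eta> \<equiv> eta (k + 2)"

text \<open>The possible discontinuities of \<open>G\<close>, lifted to the real line so that
  intervals need not be cut modulo 1.\<close>

definition is_break :: "real \<Rightarrow> bool" where
  "is_break x \<longleftrightarrow> (\<exists>i\<le>n. \<exists>z::int. x = of_int z - real i * \<alpha>)"

lemma eta_gap: "0 < \<eta>" "2 * \<eta> \<le> eta k" "2 * \<eta> \<le> 1"
  using eta_pos[of "k + 2"] two_eta_le[of k] eta_le_1[of k] by simp_all

text \<open>If the floors of \<open>s + i \<alpha>\<close> and \<open>t + i \<alpha>\<close> differ,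
  an integer translate of \<open>-i \<alpha>\<close> lies in \<open>(s, t]\<close>.\<close>

lemma constant_between:
  assumes "s \<le> t" "\<And>x. s < x \<Longrightarrow> x \<le> t \<Longrightarrow> \<not> is_break x"
  shows "G s = G t"
proof (rule coded)
  have eq: "\<lfloor>s + real i * \<alpha>\<rfloor> = \<lfloor>t + real i * \<alpha>\<rfloor>" if "i \<le> n" for i
  proof (rule antisym)
    show "\<lfloor>s + real i * \<alpha>\<rfloor> \<le> \<lfloor>t + real i * \<alpha>\<rfloor>" using assms(1) by (intro floor_mono) simp
    let ?x = "of_int \<lfloor>t + real i * \<alpha>\<rfloor> - real i * \<alpha>"
    have "is_break ?x" using that unfolding is_break_def by blast
    moreover have "?x \<le> t" using of_int_floor_le[of "t + real i * \<alpha>"] by linarith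
    ultimately have "?x \<le> s" using assms(2)[of ?x] by fastforce
    then show "\<lfloor>t + real i * \<alpha>\<rfloor> \<le> \<lfloor>s + real i * \<alpha>\<rfloor>" by (simp add: le_floor_iff)
  qed
  from eq[of 0] have "\<lfloor>s\<rfloor> = \<lfloor>t\<rfloor>" by simp
  then show "same_floors \<alpha> n s t" using eq by (simp add: same_floors_def)
qed

text \<open>The difference is \<open>m \<alpha> - w\<close> up to sign, with
  \<open>m \<le> n < r_k \<le> q_(k+1)\<close>, so it is at least \<open>eta k\<close> by best
  approximation, or at least 1 if \<open>m = 0\<close>.\<close>

lemma break_separated:
  assumes "is_break x" "is_break y" "x \<noteq> y"
  shows "2 * \<eta> \<le> \<bar>x - y\<bar>"
proof -
  have *: "2 * \<eta> \<le> \<bar>real m * \<alpha> - of_int w\<bar>" if "m \<le> n" "real m * \<alpha> - of_int w \<noteq> 0" for m w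
  proof (cases "m = 0")
    case True
    then have "w \<noteq> 0" using that by simp
    then have "1 \<le> real_of_int \<bar>w\<bar>" by (subst of_int_1_le_iff) linarith
    then show ?thesis using True eta_gap(3) by simp
  next
    case False
    obtain k' where k': "k = Suc k'" using k_pos by (cases k) auto
    have "m < cf_q c (Suc k)"
      using that(1) n_less cf_q_add_le[of k'] by (simp add: k' del: cf_q.simps)
    then have "eta k \<le> \<bar>real m * \<alpha> - of_int w\<bar>" using False by (intro best_approximation) auto
    then show ?thesis using eta_gap(2) by linarith
  qed
  obtain i z j w where x: "i \<le> n" "x = of_int z - real i * \<alpha>"
    and y: "j \<le> n" "y = of_int w - real j * \<alpha>"
    using assms(1,2) unfolding is_break_def by blast
  show ?thesis
  proof (cases "i \<le> j")
    case True
    then have "x - y = real (j - i) * \<alpha> - of_int (w - z)"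
      using x y by (simp add: of_nat_diff algebra_simps)
    then show ?thesis using *[of "j - i" "w - z"] y(1) assms(3) by simp
  next
    case False
    then have "y - x = real (i - j) * \<alpha> - of_int (z - w)"
      using x y by (simp add: of_nat_diff algebra_simps)
    then have "2 * \<eta> \<le> \<bar>y - x\<bar>" using *[of "i - j" "z - w"] x(1) assms(3) by simp
    then show ?thesis by (simp add: abs_minus_commute)
  qed
qed

text \<open>\<open>jump\<close> concerns arbitrarily small \<open>e\<close> only. No other break is
  within \<open>\<eta>\<close>, so \<open>G\<close> is constant on each side that far and the
  inequality spreads.\<close>

lemma jump_values:
  assumes p: "p = 0 \<or> p = n" and e: "0 < e" "e \<le> \<eta>" and d: "0 \<le> d" "d < \<eta>"
  shows "G (of_int z - real p * \<alpha> - e) \<noteq> G (of_int z - real p * \<alpha> + d)"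
proof -
  define x where "x = - (real p * \<alpha>)"
  have x: "is_break x"
    unfolding is_break_def x_def using p by (intro exI[of _ p] conjI exI[of _ 0]) auto
  have nobreak: "\<not> is_break y" if "y \<noteq> x" "x - \<eta> < y" "y < x + \<eta>" for y
  proof
    assume "is_break y"
    then have "2 * \<eta> \<le> \<bar>y - x\<bar>" using break_separated x that(1) by blast
    then show False using that eta_gap(1) by linarith
  qed
  obtain e0 where e0: "e0 > 0" "\<And>e. 0 < e \<Longrightarrow> e < e0 \<Longrightarrow> G (x - e) \<noteq> G x"
    using jump[OF p] unfolding x_def by blast
  define e1 where "e1 = min e (e0 / 2)"
  have e1: "0 < e1" "e1 < e0" "e1 \<le> e" using e e0(1) by (auto simp: e1_def)
  have "G (x - e) = G (x - e1)"
    by (rule constant_between) (use e e1 nobreak eta_gap(1) in auto)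
  moreover have "G x = G (x + d)"
    by (rule constant_between) (use d nobreak eta_gap(1) in auto)
  ultimately have "G (x - e) \<noteq> G (x + d)" using e0(2)[OF e1(1,2)] by simp
  moreover have "G (of_int z - real p * \<alpha> - e) = G (x - e)"
    using periodic[of "x - e" z] by (simp add: x_def algebra_simps)
  moreover have "G (of_int z - real p * \<alpha> + d) = G (x + d)"
    using periodic[of "x + d" z] by (simp add: x_def algebra_simps)
  ultimately show ?thesis by simp
qed

section \<open>Two orbits coded alike for \<open>N\<close> steps\<close>

context
  fixes N :: nat and u v :: real
  assumes agree: "\<And>j. j < N \<Longrightarrow> G (u + real j * \<alpha>) = G (v + real j * \<alpha>)"
begin

lemma agree_shifted:
  assumes "j < N" "t = u + real j * \<alpha> - of_int z"
  shows "G t = G (t + (v - u))"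
proof -
  have "G t = G (u + real j * \<alpha>)" using periodic[of t z] assms(2) by simp
  moreover have "G (t + (v - u)) = G (v + real j * \<alpha>)"
  proof -
    have "t + (v - u) + of_int z = v + real j * \<alpha>" using assms(2) by simp
    then show ?thesis using periodic[of "t + (v - u)" z] by (simp only:)
  qed
  ultimately show ?thesis using agree[OF assms(1)] by simp
qed

lemma agree_hits:
  assumes "s + cf_r c (k + 3) \<le> N" "\<eta> \<le> L"
  obtains j z where "s \<le> j" "j < s + cf_r c (k + 3)" "a \<le> u + real j * \<alpha> - of_int z"
    "u + real j * \<alpha> - of_int z < a + L"
proof -
  obtain j z where "j < cf_r c (Suc (k + 2))" "a \<le> u + real s * \<alpha> + real j * \<alpha> - of_int z"
    "u + real s * \<alpha> + real j * \<alpha> - of_int z < a + L"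
    using orbit_hits[OF assms(2)] by blast
  then show ?thesis using that[of "s + j" z]
    by (simp add: algebra_simps eval_nat_numeral del: cf_r.simps)
qed

text \<open>Otherwise the coding shifted by \<open>v - u\<close> would be constant across the jump at
  \<open>-p \<alpha>\<close>, and so differ from the coding on an interval of length \<open>\<eta>\<close> on one side of it.\<close>

lemma shifted_break_near_jump:
  assumes p: "p = 0 \<or> p = n" and N: "cf_r c (k + 3) \<le> N"
  obtains b z e where "b \<le> n" "e = of_int z - (v - u) - real b * \<alpha> + real p * \<alpha>"
    "\<bar>e\<bar> < \<eta>"
    "\<And>t. 0 \<le> t \<and> t < e \<or> e \<le> t \<and> t < 0 \<Longrightarrow>
        G (t - real p * \<alpha>) \<noteq> G (t - real p * \<alpha> + (v - u))"
proof -
  define W where "W t = G (t - real p * \<alpha> + (v - u))" for t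
  have hit: "\<exists>t. a \<le> t \<and> t < a + \<eta> \<and> G (t - real p * \<alpha>) = W t" for a
  proof -
    obtain j z where j: "j < cf_r c (k + 3)" "a - real p * \<alpha> \<le> u + real j * \<alpha> - of_int z"
      "u + real j * \<alpha> - of_int z < a - real p * \<alpha> + \<eta>"
      by (rule agree_hits[of 0 \<eta> "a - real p * \<alpha>"]) (use N in auto)
    define t where "t = u + real j * \<alpha> - of_int z + real p * \<alpha>"
    have "G (t - real p * \<alpha>) = W t"
      unfolding W_def by (rule agree_shifted[of j _ z]) (use j N in \<open>auto simp: t_def\<close>)
    moreover have "a \<le> t" "t < a + \<eta>" using j by (auto simp: t_def)
    ultimately show ?thesis by blast
  qed
  \<comment> \<open>Points of agreement on both sides of the jump transfer its change of value to
    \<open>W\<close>, which must then have a break between them.\<close>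
  obtain t1 where t1: "- \<eta> \<le> t1" "t1 < 0" "G (t1 - real p * \<alpha>) = W t1" using hit[of "- \<eta>"] by auto
  obtain t2 where t2: "0 \<le> t2" "t2 < \<eta>" "G (t2 - real p * \<alpha>) = W t2" using hit[of 0] by auto
  have jmp: "G (s - real p * \<alpha>) \<noteq> G (t - real p * \<alpha>)" if "- \<eta> \<le> s" "s < 0" "0 \<le> t" "t < \<eta>" for s t
    using jump_values[OF p, of "- s" t 0] that by simp
  define brk where "brk x \<longleftrightarrow> is_break (x - real p * \<alpha> + (v - u))" for x
  have W_const: "W s = W t" if "s \<le> t" "\<And>x. s < x \<Longrightarrow> x \<le> t \<Longrightarrow> \<not> brk x" for s t
    unfolding W_def
  proof (rule constant_between)
    fix x assume "s - real p * \<alpha> + (v - u) < x" "x \<le> t - real p * \<alpha> + (v - u)"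
    then show "\<not> is_break x" using that(2)[of "x + real p * \<alpha> - (v - u)"] by (simp add: brk_def)
  qed (use that in simp)
  have "W t1 \<noteq> W t2" using jmp[of t1 t2] t1 t2 by simp
  then obtain e where e: "t1 < e" "e \<le> t2" "brk e"
    using W_const[of t1 t2] t1 t2 by force
  have other: "\<not> brk x" if "x \<noteq> e" "\<bar>x - e\<bar> < 2 * \<eta>" for x
    using break_separated[of "x - real p * \<alpha> + (v - u)" "e - real p * \<alpha> + (v - u)"] that e(3)
    unfolding brk_def by auto
  obtain b z where b: "b \<le> n" "e - real p * \<alpha> + (v - u) = of_int z - real b * \<alpha>"
    using e(3) unfolding brk_def is_break_def by blast
  show ?thesis
  proof (rule that[OF b(1)])
    show "e = of_int z - (v - u) - real b * \<alpha> + real p * \<alpha>" using b(2) by simp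
    show "\<bar>e\<bar> < \<eta>" using e t1 t2 by linarith
  next
    fix t assume "0 \<le> t \<and> t < e \<or> e \<le> t \<and> t < 0"
    then show "G (t - real p * \<alpha>) \<noteq> G (t - real p * \<alpha> + (v - u))"
    proof
      \<comment> \<open>No break of \<open>W\<close> other than \<open>e\<close> is near, so
        \<open>W t\<close> is still \<open>W t1\<close>, a value of \<open>G\<close> left of the
        jump, whereas \<open>t\<close> is right of it.\<close>
      assume t: "0 \<le> t \<and> t < e"
      have "W t1 = W t" by (rule W_const) (use t t1 t2 e other in auto)
      then show ?thesis using jmp[of t1 t] t t1 t2 e unfolding W_def[symmetric] by simp
    next
      assume t: "e \<le> t \<and> t < 0"
      have "W t = W t2" by (rule W_const) (use t t1 t2 e other in auto)
      then show ?thesis using jmp[of t t2] t t1 t2 e unfolding W_def[symmetric] by simp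
    qed
  qed
qed

lemma agree_close:
  assumes N: "cf_r c (k + 3) + 2 * cf_r c k \<le> N + n + 2"
  obtains z :: int where "\<bar>v - u - of_int z\<bar> < \<eta>"
proof -
  define \<delta> where "\<delta> = v - u"
  have rN: "cf_r c (k + 3) \<le> N" using N n_less by linarith
  obtain b z0 e0 where b: "b \<le> n" and e0: "e0 = of_int z0 - \<delta> - real b * \<alpha>" "\<bar>e0\<bar> < \<eta>"
    and D0: "\<And>t. 0 \<le> t \<and> t < e0 \<or> e0 \<le> t \<and> t < 0 \<Longrightarrow> G t \<noteq> G (t + \<delta>)"
    by (rule shifted_break_near_jump[of 0]) (use rN in \<open>auto simp: \<delta>_def\<close>)
  obtain b' z1 e1 where b': "b' \<le> n"
    and e1: "e1 = of_int z1 - \<delta> - real b' * \<alpha> + real n * \<alpha>" "\<bar>e1\<bar> < \<eta>"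
    and D1: "\<And>t. 0 \<le> t \<and> t < e1 \<or> e1 \<le> t \<and> t < 0 \<Longrightarrow>
      G (t - real n * \<alpha>) \<noteq> G (t - real n * \<alpha> + \<delta>)"
    by (rule shifted_break_near_jump[of n]) (use rN in \<open>auto simp: \<delta>_def\<close>)
  \<comment> \<open>Subtracting the two displacements eliminates \<open>\<delta>\<close> and leaves
    this multiple of \<open>\<alpha>\<close>, up to an integer.\<close>
  define m where "m = n - b' + b"
  have m: "m \<le> 2 * n" using b b' by (simp add: m_def)
  have diff: "e1 - e0 = real m * \<alpha> - of_int (z0 - z1)"
    using b b' by (simp add: e0(1) e1(1) m_def of_nat_diff algebra_simps)
  have "m = 0"
  proof (rule ccontr)
    assume "m \<noteq> 0"
    \<comment> \<open>\<open>m \<le> 2 n < 2 r_k \<le> 2 q_(k+1) \<le> q_(k+1) + q_(k+2) \<le>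
      q_(k+3)\<close>.\<close>
    have "m < cf_q c (Suc (k + 2))"
    proof -
      obtain k' where k': "k = Suc k'" using k_pos by (cases k) auto
      have "m < 2 * (cf_q c k + cf_q c k')" using m n_less by (simp add: k')
      then show ?thesis
        using cf_q_add_le[of k'] cf_q_add_le[of k] cf_q_add_le[of "Suc k"]
        by (simp add: k' del: cf_q.simps)
    qed
    then have "\<eta> \<le> \<bar>e1 - e0\<bar>"
      unfolding diff using \<open>m \<noteq> 0\<close> by (intro best_approximation) auto
    \<comment> \<open>The point \<open>-n \<alpha>\<close> is inspected at time
      \<open>j + m - n\<close>, so \<open>j\<close> starts at \<open>n - m\<close> if
      \<open>m < n\<close> and at \<open>0\<close> otherwise. Since \<open>n < r_k\<close>, the
      assumption on \<open>N\<close> gives \<open>N \<ge> r_(k+3) + n\<close>, which bounds both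
      times.\<close>
    define s where "s = n - m"
    have s: "s + cf_r c (k + 3) \<le> N" using N n_less \<open>m \<noteq> 0\<close> unfolding s_def by linarith
    text \<open>The forbidden intervals at \<open>0\<close> and, moved by \<open>(n - m) \<alpha>\<close>, at \<open>-n \<alpha>\<close> join up to an
      interval of length \<open>\<bar>e1 - e0\<bar> \<ge> \<eta>\<close>.\<close>
    have contra: False if j: "s \<le> j" "j < s + cf_r c (k + 3)" and t: "t = u + real j * \<alpha> - of_int z"
      and int: "0 \<le> t \<and> t < e0 \<or> e0 \<le> t \<and> t < 0 \<or>
        0 \<le> t + (e1 - e0) \<and> t + (e1 - e0) < e1 \<or> e1 \<le> t + (e1 - e0) \<and> t + (e1 - e0) < 0" for j t z
    proof (cases "0 \<le> t \<and> t < e0 \<or> e0 \<le> t \<and> t < 0")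
      case True
      have "j < N" using j s by simp
      then show False using D0[OF True] agree_shifted[OF _ t] by (simp add: \<delta>_def)
    next
      case False
      define i where "i = j + m - n"
      have jmn: "n \<le> j + m" using j(1) by (simp add: s_def)
      have "i < N" using j N n_less m unfolding i_def s_def by linarith
      moreover have "t + (e1 - e0) - real n * \<alpha> = u + real i * \<alpha> - of_int (z + (z0 - z1))"
        using jmn by (simp add: diff t i_def of_nat_diff algebra_simps)
      ultimately show False using D1[of "t + (e1 - e0)"] int False agree_shifted \<delta>_def by blast
    qed
    show False
    proof (cases "e0 \<le> e1")
      case True
      \<comment> \<open>As both displacements are smaller than \<open>\<eta>\<close>, this forces
        \<open>e0 < 0 < e1\<close>: the intervals \<open>[e0 - e1, e0)\<close> and
        \<open>[e0, 0)\<close> meet at \<open>e0\<close>. The other case is symmetric.\<close>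
      then have L: "\<eta> \<le> e1 - e0" using \<open>\<eta> \<le> \<bar>e1 - e0\<bar>\<close> by simp
      obtain j z where "s \<le> j" "j < s + cf_r c (k + 3)" "e0 - e1 \<le> u + real j * \<alpha> - of_int z"
        "u + real j * \<alpha> - of_int z < e0 - e1 + (e1 - e0)"
        using agree_hits[OF s L] by blast
      then show False using contra[OF _ _ refl, of j z] L e0(2) e1(2) by linarith
    next
      case False
      then have L: "\<eta> \<le> e0 - e1" using \<open>\<eta> \<le> \<bar>e1 - e0\<bar>\<close> by simp
      obtain j z where "s \<le> j" "j < s + cf_r c (k + 3)" "0 \<le> u + real j * \<alpha> - of_int z"
        "u + real j * \<alpha> - of_int z < 0 + (e0 - e1)"
        using agree_hits[OF s L] by blast
      then show False using contra[OF _ _ refl, of j z] L e0(2) e1(2) by linarith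
    qed
  qed
  then have "b = 0" by (simp add: m_def)
  then show ?thesis using that[of z0] e0 by (simp add: \<delta>_def abs_minus_commute)
qed

end

lemma agree_close_imp_same_floors:
  assumes agree: "\<And>j. j < N \<Longrightarrow> G (u + real j * \<alpha>) = G (v + real j * \<alpha>)"
    and nN: "n \<le> N" "0 < N" and "u \<le> v" "v - u < \<eta>"
  shows "same_floors \<alpha> (N + n - 1) u v"
proof -
  have eq: "\<lfloor>u + real i * \<alpha>\<rfloor> = \<lfloor>v + real i * \<alpha>\<rfloor>" if i: "i \<le> N + n - 1" for i
  proof (rule ccontr)
    assume "\<lfloor>u + real i * \<alpha>\<rfloor> \<noteq> \<lfloor>v + real i * \<alpha>\<rfloor>"
    moreover have "\<lfloor>u + real i * \<alpha>\<rfloor> \<le> \<lfloor>v + real i * \<alpha>\<rfloor>" using assms(4) by (intro floor_mono) simp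
    ultimately have "\<lfloor>u + real i * \<alpha>\<rfloor> < \<lfloor>v + real i * \<alpha>\<rfloor>" by simp
    then obtain w :: int where w: "u + real i * \<alpha> < of_int w" "of_int w \<le> v + real i * \<alpha>"
      using floor_less_iff of_int_floor_le by blast
    \<comment> \<open>The separating point reaches \<open>0\<close> after \<open>i\<close> steps, or
      \<open>-n \<alpha>\<close> after \<open>i - n\<close> steps; \<open>n \<le> N\<close> ensures
      that one of these times is available.\<close>
    obtain p j where p: "p = 0 \<or> p = n" and j: "j < N" "i = p + j"
    proof (cases "i < N")
      case True
      then show ?thesis using that[of 0 i] by simp
    next
      case False
      then show ?thesis using that[of n "i - n"] i nN by simp
    qed
    define e where "e = of_int w - real p * \<alpha> - (u + real j * \<alpha>)"
    define d where "d = v + real j * \<alpha> - (of_int w - real p * \<alpha>)"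
    have "G (of_int w - real p * \<alpha> - e) \<noteq> G (of_int w - real p * \<alpha> + d)"
      by (rule jump_values[OF p]) (use w j(2) assms(5) in \<open>simp_all add: e_def d_def algebra_simps\<close>)
    then show False using agree[OF j(1)] by (simp add: e_def d_def)
  qed
  from eq[of 0] have "\<lfloor>u\<rfloor> = \<lfloor>v\<rfloor>" by simp
  then show ?thesis using eq by (simp add: same_floors_def)
qed

theorem agree_iff_same_floors:
  assumes N: "N = cf_r c (k + 3) + 2 * cf_r c k - n - 2"
  shows "(\<forall>j<N. G (u + real j * \<alpha>) = G (v + real j * \<alpha>)) \<longleftrightarrow> same_floors \<alpha> (N + n - 1) u v"
proof
  assume same: "same_floors \<alpha> (N + n - 1) u v"
  show "\<forall>j<N. G (u + real j * \<alpha>) = G (v + real j * \<alpha>)"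
  proof (intro allI impI coded)
    fix j assume "j < N"
    then have "same_floors \<alpha> (n + j) u v" using same by (simp add: same_floors_def)
    then show "same_floors \<alpha> n (u + real j * \<alpha>) (v + real j * \<alpha>)" by (rule same_floors_orbit)
  qed
next
  assume agree: "\<forall>j<N. G (u + real j * \<alpha>) = G (v + real j * \<alpha>)"
  have pos: "0 < cf_r c (k + 3)" using cf_q_pos[of "k + 3"] by (simp add: eval_nat_numeral del: cf_q.simps)
  obtain z :: int where z: "\<bar>v - u - of_int z\<bar> < \<eta>"
    by (rule agree_close[of N u v]) (use agree N in auto)
  \<comment> \<open>An integer translate turns closeness on the circle into closeness on the
    line.\<close>
  define v' where "v' = v + of_int (- z)"
  have agree': "G (u + real j * \<alpha>) = G (v' + real j * \<alpha>)" if "j < N" for j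
    using agree that periodic[of "v + real j * \<alpha>" "- z"] by (simp add: v'_def algebra_simps)
  have nN: "n \<le> N" "0 < N" using N n_less pos by linarith+
  have "same_floors \<alpha> (N + n - 1) u v'"
  proof (cases "u \<le> v'")
    case True
    then show ?thesis using agree_close_imp_same_floors[of N u v'] agree' nN z by (simp add: v'_def)
  next
    case False
    then show ?thesis using agree_close_imp_same_floors[of N v' u] agree' nN z
      by - (rule same_floors_sym, simp add: v'_def)
  qed
  then show "same_floors \<alpha> (N + n - 1) u v"
    unfolding v'_def using same_floors_shift same_floors_sym by blast
qed

end

section \<open>Partitions of the circle as level sets\<close>

text \<open>With partitions given as level sets, pullbacks and powers become operations on
  functions, and two partitions are equal once the functions identify the same points.\<close>

definition classes :: "(real \<Rightarrow> 'b) \<Rightarrow> real set set" where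
  "classes g = (\<lambda>x. {y \<in> circle. g y = g x}) ` circle"

lemma classes_cong:
  assumes "\<And>x y. x \<in> circle \<Longrightarrow> y \<in> circle \<Longrightarrow> g x = g y \<longleftrightarrow> h x = h y"
  shows "classes g = classes h"
  unfolding classes_def by (intro image_cong refl Collect_cong) (use assms in auto)

lemma partition_on_classes: "partition_on circle (classes g)"
  unfolding classes_def by (intro partition_onI) (auto simp: disjnt_def)

lemma frac_in_circle: "frac x \<in> circle"
  by (simp add: circle_def frac_lt_1)

lemma frac_eq_of_circle: "x \<in> circle \<Longrightarrow> frac x = x"
  by (simp add: circle_def frac_eq)

lemma rot_funpow:
  assumes "x \<in> circle"
  shows "(rot \<alpha> ^^ j) x = frac (x + real j * \<alpha>)"
proof (induction j)
  case 0
  then show ?case using frac_eq_of_circle[OF assms] by simp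
next
  case (Suc j)
  then show ?case by (simp add: rot_def algebra_simps)
qed

lemma rot_funpow_in_circle: "x \<in> circle \<Longrightarrow> (rot \<alpha> ^^ j) x \<in> circle"
  by (simp add: rot_funpow frac_in_circle)

lemma rot_funpow_surj:
  assumes "x \<in> circle"
  obtains y where "y \<in> circle" "(rot \<alpha> ^^ j) y = x"
proof
  show "frac (x - real j * \<alpha>) \<in> circle" by (rule frac_in_circle)
  then show "(rot \<alpha> ^^ j) (frac (x - real j * \<alpha>)) = x"
    using assms by (simp add: rot_funpow frac_eq_of_circle)
qed

lemma preim_class:
  "x \<in> circle \<Longrightarrow> preim \<alpha> j {y \<in> circle. g y = g x} = {y \<in> circle. g ((rot \<alpha> ^^ j) y) = g x}"
  by (auto simp: preim_def rot_funpow_in_circle)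

text \<open>Since the rotation is surjective on the circle, the preimage of a class is nonempty and
  so again a class.\<close>

lemma pull_classes: "pull \<alpha> j (classes g) = classes (\<lambda>x. g ((rot \<alpha> ^^ j) x))"
proof (intro set_eqI iffI)
  fix A assume "A \<in> pull \<alpha> j (classes g)"
  then obtain x where x: "x \<in> circle" "A = {y \<in> circle. g ((rot \<alpha> ^^ j) y) = g x}"
    by (auto simp: pull_def classes_def preim_class)
  obtain y where "y \<in> circle" "(rot \<alpha> ^^ j) y = x" using rot_funpow_surj[OF x(1)] by blast
  then show "A \<in> classes (\<lambda>x. g ((rot \<alpha> ^^ j) x))" using x(2) unfolding classes_def by blast
next
  fix A assume "A \<in> classes (\<lambda>x. g ((rot \<alpha> ^^ j) x))"
  then obtain x where x: "x \<in> circle" "A = {y \<in> circle. g ((rot \<alpha> ^^ j) y) = g ((rot \<alpha> ^^ j) x)}"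
    by (auto simp: classes_def)
  have "A = preim \<alpha> j {y \<in> circle. g y = g ((rot \<alpha> ^^ j) x)}"
    unfolding x(2) by (intro preim_class[symmetric] rot_funpow_in_circle x(1))
  then show "A \<in> pull \<alpha> j (classes g)"
    unfolding pull_def classes_def using rot_funpow_in_circle[OF x(1)] by blast
qed

text \<open>A nonempty intersection is the set of points with a given itinerary through the classes;
  itineraries that no point follows give the removed empty set.\<close>

lemma part_pow_classes:
  assumes "m \<ge> 1"
  shows "part_pow \<alpha> (classes g) m = classes (\<lambda>x. map (\<lambda>j. g ((rot \<alpha> ^^ j) x)) [0..<m])"
    (is "_ = classes ?h")
proof -
  have h: "?h y = ?h x \<longleftrightarrow> (\<forall>j<m. g ((rot \<alpha> ^^ j) y) = g ((rot \<alpha> ^^ j) x))" for x y by auto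
  have cell: "(\<Inter>j<m. preim \<alpha> j {y \<in> circle. g y = g ((rot \<alpha> ^^ j) x)}) = {y \<in> circle. ?h y = ?h x}"
    if "x \<in> circle" for x
  proof -
    \<comment> \<open>An intersection over no indices would be \<open>UNIV\<close>, not
      \<open>circle\<close>.\<close>
    have "0 \<in> {..<m}" using assms by simp
    then have "{..<m} \<noteq> {}" by blast
    then show ?thesis unfolding h using that by (auto simp: preim_class rot_funpow_in_circle)
  qed
  show ?thesis
  proof (intro set_eqI iffI)
    fix A assume "A \<in> part_pow \<alpha> (classes g) m"
    then obtain f where f: "\<And>j. j < m \<Longrightarrow> f j \<in> classes g" and A: "A = (\<Inter>j<m. preim \<alpha> j (f j))"
      and "A \<noteq> {}" unfolding part_pow_def by blast
    then obtain x where x: "x \<in> A" by blast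
    have "0 < m" using assms by simp
    then have xc: "x \<in> circle" using A x unfolding preim_def by blast
    have "f j = {y \<in> circle. g y = g ((rot \<alpha> ^^ j) x)}" if j: "j < m" for j
    proof -
      have "(rot \<alpha> ^^ j) x \<in> f j" using x A j unfolding preim_def by blast
      moreover obtain z where z: "f j = {y \<in> circle. g y = g z}"
        using f[OF j] unfolding classes_def by blast
      ultimately have "g ((rot \<alpha> ^^ j) x) = g z" by blast
      then show ?thesis unfolding z by (simp only:)
    qed
    then have "A = (\<Inter>j<m. preim \<alpha> j {y \<in> circle. g y = g ((rot \<alpha> ^^ j) x)})"
      unfolding A by (intro INF_cong refl) (simp only: lessThan_iff)
    then have "A = {y \<in> circle. ?h y = ?h x}" unfolding cell[OF xc] .
    then show "A \<in> classes ?h" unfolding classes_def using xc by blast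
  next
    fix A assume "A \<in> classes ?h"
    then obtain x where x: "x \<in> circle" "A = {y \<in> circle. ?h y = ?h x}" unfolding classes_def by blast
    have "A = (\<Inter>j<m. preim \<alpha> j {y \<in> circle. g y = g ((rot \<alpha> ^^ j) x)})"
      unfolding cell[OF x(1)] by (rule x(2))
    moreover have "A \<noteq> {}" using x by blast
    moreover have "\<forall>j<m. {y \<in> circle. g y = g ((rot \<alpha> ^^ j) x)} \<in> classes g"
      unfolding classes_def using rot_funpow_in_circle[OF x(1)] by blast
    ultimately show "A \<in> part_pow \<alpha> (classes g) m"
      unfolding part_pow_def by (intro DiffI CollectI exI[of _ "\<lambda>j. {y \<in> circle. g y = g ((rot \<alpha> ^^ j) x)}"]) auto
  qed
qed

definition cell_of :: "real set set \<Rightarrow> real \<Rightarrow> real set" where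
  "cell_of R x = (THE A. A \<in> R \<and> x \<in> A)"

lemma cell_of_eq:
  assumes "partition_on circle R" "A \<in> R" "x \<in> A"
  shows "cell_of R x = A"
  unfolding cell_of_def
proof (rule the_equality)
  fix B assume "B \<in> R \<and> x \<in> B"
  then show "B = A" using assms partition_onD2[OF assms(1)] unfolding disjoint_def by blast
qed (use assms in simp)

lemma classes_cell_of:
  assumes R: "partition_on circle R"
  shows "classes (cell_of R) = R"
proof -
  have cell: "{y \<in> circle. cell_of R y = cell_of R x} = A" if "A \<in> R" "x \<in> A" for A x
    unfolding cell_of_eq[OF R that]
  proof (intro set_eqI iffI)
    fix y assume "y \<in> {y \<in> circle. cell_of R y = A}"
    then obtain B where "B \<in> R" "y \<in> B" "cell_of R y = A" using partition_onD1[OF R] by blast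
    then show "y \<in> A" using cell_of_eq[OF R] by blast
  next
    fix y assume "y \<in> A"
    then show "y \<in> {y \<in> circle. cell_of R y = A}"
      using cell_of_eq[OF R that(1)] partition_onD1[OF R] that(1) by blast
  qed
  show ?thesis
  proof (intro set_eqI iffI)
    fix A assume "A \<in> classes (cell_of R)"
    then obtain x where x: "x \<in> circle" "A = {y \<in> circle. cell_of R y = cell_of R x}"
      unfolding classes_def by blast
    then obtain B where "B \<in> R" "x \<in> B" using partition_onD1[OF R] by blast
    then show "A \<in> R" using cell x by simp
  next
    fix A assume A: "A \<in> R"
    then obtain x where "x \<in> A" using partition_onD3[OF R] by (metis all_not_in_conv)
    then show "A \<in> classes (cell_of R)"
      unfolding classes_def using cell[OF A] A partition_onD1[OF R] by blast
  qed
qed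

lemma refines_classes_iff:
  assumes R: "partition_on circle R"
  shows "refines circle (classes g) R \<longleftrightarrow>
    (\<forall>x\<in>circle. \<forall>y\<in>circle. g x = g y \<longrightarrow> cell_of R x = cell_of R y)"
proof (intro iffI ballI impI)
  fix x y assume ref: "refines circle (classes g) R" and xy: "x \<in> circle" "y \<in> circle" "g x = g y"
  have "{z \<in> circle. g z = g x} \<in> classes g" unfolding classes_def using xy(1) by blast
  then obtain B where "B \<in> R" "{z \<in> circle. g z = g x} \<subseteq> B" using ref unfolding refines_def by blast
  then have "x \<in> B" "y \<in> B" "B \<in> R" using xy by auto
  then show "cell_of R x = cell_of R y" using cell_of_eq[OF R] by metis
next
  assume *: "\<forall>x\<in>circle. \<forall>y\<in>circle. g x = g y \<longrightarrow> cell_of R x = cell_of R y"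
  have "\<exists>B\<in>R. A \<subseteq> B" if A: "A \<in> classes g" for A
  proof -
    obtain x where x: "x \<in> circle" "A = {y \<in> circle. g y = g x}"
      using A unfolding classes_def by auto
    have "{y \<in> circle. cell_of R y = cell_of R x} \<in> R"
      using x(1) classes_cell_of[OF R] unfolding classes_def by blast
    moreover have "A \<subseteq> {y \<in> circle. cell_of R y = cell_of R x}" using * x by blast
    ultimately show ?thesis by blast
  qed
  then show "refines circle (classes g) R"
    unfolding refines_def using partition_on_classes R by blast
qed

section \<open>The Sturmian partition and its refinements as level sets\<close>

lemma sturm_part_classes:
  assumes "0 < \<alpha>" "\<alpha> < 1"
  shows "sturm_part \<alpha> = classes (\<lambda>x. \<lfloor>x + \<alpha>\<rfloor>)"
proof -
  have "\<lfloor>x + \<alpha>\<rfloor> = (if x < 1 - \<alpha> then 0 else 1)" if "x \<in> circle" for x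
    using that assms by (auto simp: circle_def floor_eq_iff)
  then have "{y \<in> circle. \<lfloor>y + \<alpha>\<rfloor> = \<lfloor>x + \<alpha>\<rfloor>} = (if x < 1 - \<alpha> then {0..<1 - \<alpha>} else {1 - \<alpha>..<1})"
    if "x \<in> circle" for x
    using that assms by (auto simp: circle_def split: if_splits)
  then have "classes (\<lambda>x. \<lfloor>x + \<alpha>\<rfloor>)
      = (\<lambda>x. if x < 1 - \<alpha> then {0..<1 - \<alpha>} else {1 - \<alpha>..<1}) ` circle"
    unfolding classes_def by (intro image_cong refl) simp
  also have "\<dots> = sturm_part \<alpha>"
  proof -
    have "0 \<in> circle" "1 - \<alpha> \<in> circle" using assms by (auto simp: circle_def)
    then show ?thesis using assms unfolding sturm_part_def by (auto simp: image_iff)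
  qed
  finally show ?thesis by simp
qed

text \<open>The increments on the right are the letters of the Sturmian word of an orbit; the floors
  are their partial sums.\<close>

lemma same_floors_iff_steps:
  "same_floors \<alpha> m u v \<longleftrightarrow>
    (\<forall>j<m. \<lfloor>u + real (Suc j) * \<alpha>\<rfloor> - \<lfloor>u + real j * \<alpha>\<rfloor> = \<lfloor>v + real (Suc j) * \<alpha>\<rfloor> - \<lfloor>v + real j * \<alpha>\<rfloor>)"
proof (induction m)
  case 0
  then show ?case by (simp add: same_floors_def)
next
  case (Suc m)
  have "same_floors \<alpha> (Suc m) u v \<longleftrightarrow> same_floors \<alpha> m u v \<and>
      \<lfloor>u + real (Suc m) * \<alpha>\<rfloor> - \<lfloor>u\<rfloor> = \<lfloor>v + real (Suc m) * \<alpha>\<rfloor> - \<lfloor>v\<rfloor>"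
    unfolding same_floors_def by (auto simp only: le_Suc_eq)
  moreover have "\<lfloor>u + real m * \<alpha>\<rfloor> - \<lfloor>u\<rfloor> = \<lfloor>v + real m * \<alpha>\<rfloor> - \<lfloor>v\<rfloor>" if "same_floors \<alpha> m u v"
    using that unfolding same_floors_def by blast
  ultimately show ?case unfolding Suc.IH[symmetric] less_Suc_eq by (smt (verit) Suc.IH)
qed

definition sturm_code :: "real \<Rightarrow> nat \<Rightarrow> nat \<Rightarrow> real \<Rightarrow> int list" where
  "sturm_code \<alpha> l m x = map (\<lambda>j. \<lfloor>(rot \<alpha> ^^ (j + l)) x + \<alpha>\<rfloor>) [0..<m]"

lemma sturm_code_eq_iff:
  assumes "x \<in> circle" "y \<in> circle"
  shows "sturm_code \<alpha> l m x = sturm_code \<alpha> l m y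
    \<longleftrightarrow> same_floors \<alpha> m (x + real l * \<alpha>) (y + real l * \<alpha>)"
proof -
  have "\<lfloor>(rot \<alpha> ^^ (j + l)) x + \<alpha>\<rfloor>
      = \<lfloor>x + real l * \<alpha> + real (Suc j) * \<alpha>\<rfloor> - \<lfloor>x + real l * \<alpha> + real j * \<alpha>\<rfloor>"
    if "x \<in> circle" for x j
  proof -
    let ?t = "x + real l * \<alpha> + real j * \<alpha>"
    have "(rot \<alpha> ^^ (j + l)) x + \<alpha> = frac ?t + \<alpha>"
      using rot_funpow[OF that, of "j + l" \<alpha>] by (simp add: algebra_simps)
    also have "\<dots> = x + real l * \<alpha> + real (Suc j) * \<alpha> - of_int \<lfloor>?t\<rfloor>"
      by (simp add: frac_def algebra_simps)
    finally show ?thesis by simp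
  qed
  then show ?thesis using assms unfolding sturm_code_def same_floors_iff_steps by auto
qed

lemma pull_part_pow_sturm:
  assumes "0 < \<alpha>" "\<alpha> < 1" "m \<ge> 1"
  shows "pull \<alpha> l (part_pow \<alpha> (sturm_part \<alpha>) m) = classes (sturm_code \<alpha> l m)"
  unfolding sturm_part_classes[OF assms(1,2)] part_pow_classes[OF assms(3)] pull_classes
  by (simp add: sturm_code_def[abs_def] funpow_add)

lemma part_pow_pull_sturm:
  assumes "0 < \<alpha>" "\<alpha> < 1" "m \<ge> 1"
  shows "part_pow \<alpha> (pull \<alpha> l (sturm_part \<alpha>)) m = classes (sturm_code \<alpha> l m)"
proof -
  have "(rot \<alpha> ^^ l) ((rot \<alpha> ^^ j) x) = (rot \<alpha> ^^ (j + l)) x" for j x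
    by (metis add.commute comp_apply funpow_add)
  then show ?thesis
    unfolding sturm_part_classes[OF assms(1,2)] pull_classes part_pow_classes[OF assms(3)]
    by (simp add: sturm_code_def[abs_def])
qed

text \<open>Without a jump at \<open>-p \<alpha>\<close>, crossing that point does not change
  \<open>G\<close>, so the remaining floors determine it. Applied to \<open>p = 0\<close> and
  \<open>p = n\<close>, this makes an optimal pair improvable.\<close>

lemma no_jump_merge:
  fixes G :: "real \<Rightarrow> 'b"
  assumes periodic: "\<And>t z. G (t + of_int z) = G t"
    and coded: "\<And>s t. same_floors \<alpha> n s t \<Longrightarrow> G s = G t"
    and no_jump: "\<And>e0. 0 < e0 \<Longrightarrow>
      \<exists>e. 0 < e \<and> e < e0 \<and> G (- (real p * \<alpha>) - e) = G (- (real p * \<alpha>))"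
    and p: "p \<le> n" "n \<ge> 1"
    and floors: "\<And>i. i \<le> n \<Longrightarrow> i \<noteq> p \<Longrightarrow> \<lfloor>s + real i * \<alpha>\<rfloor> = \<lfloor>t + real i * \<alpha>\<rfloor>"
  shows "G s = G t"
proof -
  have eqI: "G s = G t" if "\<And>i. i \<le> n \<Longrightarrow> \<lfloor>s + real i * \<alpha>\<rfloor> = \<lfloor>t + real i * \<alpha>\<rfloor>" for s t
  proof (rule coded)
    from that[of 0] have "\<lfloor>s\<rfloor> = \<lfloor>t\<rfloor>" by simp
    then show "same_floors \<alpha> n s t" using that by (simp add: same_floors_def)
  qed
  have ord: "G s = G t" if "s \<le> t"
    and fl: "\<And>i. i \<le> n \<Longrightarrow> i \<noteq> p \<Longrightarrow> \<lfloor>s + real i * \<alpha>\<rfloor> = \<lfloor>t + real i * \<alpha>\<rfloor>" for s t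
  proof (cases "\<lfloor>s + real p * \<alpha>\<rfloor> = \<lfloor>t + real p * \<alpha>\<rfloor>")
    case True
    then show ?thesis using eqI[of s t] fl by blast
  next
    case False
    \<comment> \<open>A second index forces \<open>t - s < 1\<close>, so only the one translate
      \<open>x\<close> of \<open>-p \<alpha>\<close> lies between \<open>s\<close> and
      \<open>t\<close>.\<close>
    obtain i0 where "i0 \<le> n" "i0 \<noteq> p" using p by (metis le0 zero_neq_one le_trans)
    then have "t - s < 1" using fl[of i0] by linarith
    define w where "w = \<lfloor>t + real p * \<alpha>\<rfloor>"
    define x where "x = of_int w - real p * \<alpha>"
    have "\<lfloor>s + real p * \<alpha>\<rfloor> < w" using False \<open>s \<le> t\<close> floor_mono[of "s + real p * \<alpha>" "t + real p * \<alpha>"]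
      by (simp add: w_def)
    then have "s < x" by (simp add: x_def floor_less_iff)
    have "x \<le> t" using of_int_floor_le[of "t + real p * \<alpha>"] unfolding x_def w_def by linarith
    obtain e where e: "0 < e" "e < x - s" "G (- (real p * \<alpha>) - e) = G (- (real p * \<alpha>))"
      using no_jump[of "x - s"] \<open>s < x\<close> by auto
    have squeeze: "\<lfloor>y + real i * \<alpha>\<rfloor> = \<lfloor>s + real i * \<alpha>\<rfloor>" if "s \<le> y" "y \<le> t" "i \<le> n" "i \<noteq> p" for y i
      using fl[OF that(3,4)] floor_mono[of "s + real i * \<alpha>" "y + real i * \<alpha>"]
        floor_mono[of "y + real i * \<alpha>" "t + real i * \<alpha>"] that(1,2) by simp
    have "G s = G (x - e)"
    proof (rule eqI)
      fix i assume "i \<le> n"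
      show "\<lfloor>s + real i * \<alpha>\<rfloor> = \<lfloor>x - e + real i * \<alpha>\<rfloor>"
      proof (cases "i = p")
        case True
        have "x + real p * \<alpha> = of_int w" by (simp add: x_def)
        then have "\<lfloor>s + real p * \<alpha>\<rfloor> = w - 1" "\<lfloor>x - e + real p * \<alpha>\<rfloor> = w - 1"
          using e \<open>t - s < 1\<close> \<open>x \<le> t\<close> by (auto simp: floor_eq_iff)
        then show ?thesis using True by simp
      next
        case False
        then show ?thesis using squeeze[of "x - e" i] e \<open>x \<le> t\<close> \<open>i \<le> n\<close> by simp
      qed
    qed
    also have "\<dots> = G (- (real p * \<alpha>) - e)"
      using periodic[of "- (real p * \<alpha>) - e" w] by (simp add: x_def algebra_simps)
    also have "\<dots> = G x"
      using e(3) periodic[of "- (real p * \<alpha>)" w] by (simp add: x_def algebra_simps)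
    also have "\<dots> = G t"
    proof (rule eqI)
      fix i assume "i \<le> n"
      show "\<lfloor>x + real i * \<alpha>\<rfloor> = \<lfloor>t + real i * \<alpha>\<rfloor>"
      proof (cases "i = p")
        case True
        then show ?thesis by (simp add: x_def w_def)
      next
        case False
        then show ?thesis using squeeze[of x i] squeeze[of t i] \<open>s < x\<close> \<open>x \<le> t\<close> \<open>i \<le> n\<close> by simp
      qed
    qed
    finally show ?thesis .
  qed
  show ?thesis
  proof (cases "s \<le> t")
    case True
    then show ?thesis using ord floors by blast
  next
    case False
    then show ?thesis using ord[of t s] floors by simp
  qed
qed

theorem theorem2:
  fixes \<alpha> :: real and c :: "nat \<Rightarrow> nat" and R :: "real set set" and l n k :: nat
  assumes "0 < \<alpha>" and "\<alpha> < 1" and "\<alpha> \<notin> \<rat>"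
    and "has_cf \<alpha> c"
    and "sturmian_measurable \<alpha> R" and "card R \<ge> 2"
    and "optimal_pair \<alpha> R l n"
    and "k \<ge> 1" and "cf_r c (k - 1) \<le> n" and "n < cf_r c k"
  shows "part_pow \<alpha> R (cf_r c (k + 3) + 2 * cf_r c k - n - 2)
           = pull \<alpha> l (part_pow \<alpha> (sturm_part \<alpha>) (cf_r c (k + 3) + 2 * cf_r c k - 3))
       \<and> pull \<alpha> l (part_pow \<alpha> (sturm_part \<alpha>) (cf_r c (k + 3) + 2 * cf_r c k - 3))
           = part_pow \<alpha> (pull \<alpha> l (sturm_part \<alpha>)) (cf_r c (k + 3) + 2 * cf_r c k - 3)"
proof -
  have R: "partition_on circle R" using assms(5) by (simp add: sturmian_measurable_def)
  \<comment> \<open>The shift by \<open>l \<alpha>\<close> moves the first break to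
    \<open>0\<close>; \<open>frac\<close> makes \<open>G\<close> periodic on the line.\<close>
  define G where "G t = cell_of R (frac (t - real l * \<alpha>))" for t
  have G_circle: "G (x + real l * \<alpha>) = cell_of R x" if "x \<in> circle" for x
    using frac_eq_of_circle[OF that] by (simp add: G_def)
  have periodic: "G (t + of_int z) = G t" for t z
    unfolding G_def by (metis add_diff_eq add.commute frac_add_of_int_right diff_add_eq)
  have refines_iff: "refines circle (pull \<alpha> s (part_pow \<alpha> (sturm_part \<alpha>) m)) R \<longleftrightarrow>
      (\<forall>x\<in>circle. \<forall>y\<in>circle. same_floors \<alpha> m (x + real s * \<alpha>) (y + real s * \<alpha>)
        \<longrightarrow> cell_of R x = cell_of R y)" if "m \<ge> 1" for s m
    unfolding pull_part_pow_sturm[OF assms(1,2) that] refines_classes_iff[OF R]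
    by (auto simp: sturm_code_eq_iff)
  have n1: "n \<ge> 1" and ref: "refines circle (pull \<alpha> l (part_pow \<alpha> (sturm_part \<alpha>) n)) R"
    and opt: "\<And>s m. m \<ge> 1 \<Longrightarrow> refines circle (pull \<alpha> s (part_pow \<alpha> (sturm_part \<alpha>) m)) R
      \<Longrightarrow> s \<le> l \<and> n \<le> m"
    using assms(7) by (simp_all add: optimal_pair_def)
  have coded: "G u = G v" if same: "same_floors \<alpha> n u v" for u v
  proof -
    define x y where "x = frac (u - real l * \<alpha>)" and "y = frac (v - real l * \<alpha>)"
    have "x + real l * \<alpha> = u + of_int (- \<lfloor>u - real l * \<alpha>\<rfloor>)"
      "y + real l * \<alpha> = v + of_int (- \<lfloor>v - real l * \<alpha>\<rfloor>)"
      by (simp_all add: x_def y_def frac_def)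
    then have "same_floors \<alpha> n (x + real l * \<alpha>) (y + real l * \<alpha>)"
      using same by (metis same_floors_shift same_floors_sym)
    then show ?thesis
      using ref[unfolded refines_iff[OF n1]] frac_in_circle unfolding G_def x_def y_def by blast
  qed
  have merge: "G s = G t" if "\<not> (\<exists>e0>0. \<forall>e. 0 < e \<and> e < e0 \<longrightarrow>
      G (- (real p * \<alpha>) - e) \<noteq> G (- (real p * \<alpha>)))" "p \<le> n"
    "\<And>i. i \<le> n \<Longrightarrow> i \<noteq> p \<Longrightarrow> \<lfloor>s + real i * \<alpha>\<rfloor> = \<lfloor>t + real i * \<alpha>\<rfloor>" for p s t
    by (rule no_jump_merge[of G \<alpha> n p]) (use periodic coded that n1 in blast)+
  have jump: "\<exists>e0>0. \<forall>e. 0 < e \<and> e < e0 \<longrightarrow> G (- (real p * \<alpha>) - e) \<noteq> G (- (real p * \<alpha>))"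
    if p: "p = 0 \<or> p = n" for p
  proof (rule ccontr)
    assume no_jump: "\<not> ?thesis"
    \<comment> \<open>Maximality of \<open>l\<close> excludes this pair. Dropping the break at
      \<open>0\<close> leaves exponent \<open>n - 1\<close>, raised to 1 when
      \<open>n = 1\<close>.\<close>
    have "\<not> refines circle (pull \<alpha> (Suc l) (part_pow \<alpha> (sturm_part \<alpha>) (max 1 (n - 1)))) R"
      using opt[of "max 1 (n - 1)" "Suc l"] by auto
    then obtain x y where xy: "x \<in> circle" "y \<in> circle" "cell_of R x \<noteq> cell_of R y"
      and same: "same_floors \<alpha> (max 1 (n - 1)) (x + real (Suc l) * \<alpha>) (y + real (Suc l) * \<alpha>)"
      by (subst (asm) refines_iff) auto
    show False using p
    proof
      assume "p = 0"
      define u v where "u = x + real l * \<alpha>" and "v = y + real l * \<alpha>"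
      \<comment> \<open>Floors agree only up to this common integer; adding it to \<open>v\<close>
        makes them equal for all \<open>i \<ge> 1\<close>.\<close>
      define z where "z = \<lfloor>u + \<alpha>\<rfloor> - \<lfloor>v + \<alpha>\<rfloor>"
      have same': "same_floors \<alpha> (max 1 (n - 1)) (u + \<alpha>) (v + \<alpha>)"
      proof -
        have "w + real (Suc l) * \<alpha> = w + real l * \<alpha> + \<alpha>" for w by (simp add: distrib_right)
        then show ?thesis using same unfolding u_def v_def by (simp only:)
      qed
      have "G u = G (v + of_int z)"
      proof (rule merge[OF no_jump])
        fix i assume i: "i \<le> n" "i \<noteq> p"
        then have "i - 1 \<le> max 1 (n - 1)" by simp
        then have "\<lfloor>u + \<alpha> + real (i - 1) * \<alpha>\<rfloor> - \<lfloor>u + \<alpha>\<rfloor>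
            = \<lfloor>v + \<alpha> + real (i - 1) * \<alpha>\<rfloor> - \<lfloor>v + \<alpha>\<rfloor>"
          using same' unfolding same_floors_def by blast
        moreover have "w + \<alpha> + real (i - 1) * \<alpha> = w + real i * \<alpha>" for w
          using i \<open>p = 0\<close> by (cases i) (simp_all add: distrib_right)
        ultimately have "\<lfloor>u + real i * \<alpha>\<rfloor> = \<lfloor>v + real i * \<alpha>\<rfloor> + z"
          unfolding z_def by (simp only:)
        also have "\<dots> = \<lfloor>v + of_int z + real i * \<alpha>\<rfloor>"
          by (rule floor_shift[symmetric])
        finally show "\<lfloor>u + real i * \<alpha>\<rfloor> = \<lfloor>v + of_int z + real i * \<alpha>\<rfloor>" .
      qed (use p in auto)
      then show False using xy periodic G_circle by (simp add: u_def v_def)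
    next
      assume "p = n"
      \<comment> \<open>Without a jump at \<open>-n \<alpha>\<close>, the floors with
        \<open>i \<le> n - 1\<close> determine the cell, against the minimality of
        \<open>n\<close>.\<close>
      have eq: "cell_of R x = cell_of R y" if xy: "x \<in> circle" "y \<in> circle"
        and same: "same_floors \<alpha> (n - 1) (x + real l * \<alpha>) (y + real l * \<alpha>)" for x y
      proof -
        define u v where "u = x + real l * \<alpha>" and "v = y + real l * \<alpha>"
        define z where "z = \<lfloor>u\<rfloor> - \<lfloor>v\<rfloor>"
        have "G u = G (v + of_int z)"
        proof (rule merge[OF no_jump])
          fix i assume i: "i \<le> n" "i \<noteq> p"
          then have "i \<le> n - 1" using \<open>p = n\<close> by simp
          then have "\<lfloor>u + real i * \<alpha>\<rfloor> - \<lfloor>u\<rfloor> = \<lfloor>v + real i * \<alpha>\<rfloor> - \<lfloor>v\<rfloor>"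
            using same unfolding same_floors_def u_def v_def by blast
          then have "\<lfloor>u + real i * \<alpha>\<rfloor> = \<lfloor>v + real i * \<alpha>\<rfloor> + z" unfolding z_def by linarith
          also have "\<dots> = \<lfloor>v + of_int z + real i * \<alpha>\<rfloor>"
            by (rule floor_shift[symmetric])
          finally show "\<lfloor>u + real i * \<alpha>\<rfloor> = \<lfloor>v + of_int z + real i * \<alpha>\<rfloor>" .
        qed (use p in auto)
        then show ?thesis using xy periodic G_circle by (simp add: u_def v_def)
      qed
      show False
      \<comment> \<open>For \<open>n = 1\<close> no smaller positive exponent exists, but then
        \<open>cell_of R\<close> is constant, contrary to the choice of \<open>x\<close> and
        \<open>y\<close>.\<close>
      proof (cases "n = 1")
        case True
        then show False using eq[OF xy(1,2)] xy(3) by (simp add: same_floors_def)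
      next
        case False
        then have pred: "n - 1 \<ge> 1" using n1 by simp
        have "refines circle (pull \<alpha> l (part_pow \<alpha> (sturm_part \<alpha>) (n - 1))) R"
          unfolding refines_iff[OF pred] using eq by blast
        then show False using opt[OF pred] n1 by force
      qed
    qed
  qed
  interpret rotation_coding \<alpha> c G n k
    by unfold_locales (use assms periodic coded jump in auto)
  define N where "N = cf_r c (k + 3) + 2 * cf_r c k - n - 2"
  define M where "M = cf_r c (k + 3) + 2 * cf_r c k - 3"
  have pos: "cf_r c (k + 3) > 0"
    using cf_q_pos[of "k + 3"] by (simp add: eval_nat_numeral del: cf_q.simps)
  \<comment> \<open>From \<open>n < r_k\<close> follows
    \<open>2 r_k - n - 2 \<ge> n \<ge> 1\<close>, so no subtraction is truncated.\<close>
  have N: "N \<ge> 1" "M \<ge> 1" "M = N + n - 1" using pos assms(10) n1 unfolding N_def M_def by linarith+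
  have "part_pow \<alpha> R N = part_pow \<alpha> (classes (cell_of R)) N" by (simp add: classes_cell_of[OF R])
  also have "\<dots> = classes (sturm_code \<alpha> l M)"
    unfolding part_pow_classes[OF N(1)]
  proof (rule classes_cong)
    fix x y assume xy: "x \<in> circle" "y \<in> circle"
    have "cell_of R ((rot \<alpha> ^^ j) x) = G (x + real l * \<alpha> + real j * \<alpha>)" if "x \<in> circle" for x j
      using rot_funpow[OF that, of j \<alpha>] by (simp add: G_def)
    then show "map (\<lambda>j. cell_of R ((rot \<alpha> ^^ j) x)) [0..<N] = map (\<lambda>j. cell_of R ((rot \<alpha> ^^ j) y)) [0..<N]
        \<longleftrightarrow> sturm_code \<alpha> l M x = sturm_code \<alpha> l M y"
      using agree_iff_same_floors[OF N_def, of "x + real l * \<alpha>" "y + real l * \<alpha>"] xy N(3)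
      by (auto simp: sturm_code_eq_iff)
  qed
  finally show ?thesis
    using pull_part_pow_sturm[OF assms(1,2) N(2)] part_pow_pull_sturm[OF assms(1,2) N(2)]
    unfolding N_def M_def by simp
qed

end
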